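(* For every $n\ge0$, the map $SSA$ sending a word $w\in A^*$ of length $n$ to the pair $(\mathrm{bst}(w),\ \mathcal{T}(\mathrm{std}(w)^{-1}))$ is a bijection between the set of words of length $n$ over $A$ and the set of pairs $(t_1,t_2)$ where $t_1$ is a binary search tree with $n$ nodes labeled by letters of $A$ and $t_2$ is a standard decreasing tree having the same shape as $t_1$. Its inverse is the map $SSB$ which sends such a pair $(t_1,t_2)$ to the word obtained by reading the labels of $t_1$ in the order given by the corresponding labels of $t_2$, i.e. the $i$-th letter of $SSB(t_1,t_2)$ is the label of $t_1$ at the node where $t_2$ has label $i$.
   Context: $A$ is a totally ordered infinite alphabet, identified with $\{1<2<\cdots\}$ for permutations. For a word $w$ of length $n$, $\mathrm{std}(w)\in S_n$ is obtained by scanning $w$ from left to right and labelling $1,2,\dots$ the occurrences of its smallest letter, then continuing with the occurrences of the next smallest letter, and so on. A binary tree is either empty or a node with left and right (possibly empty) subtrees; its shape is the underlying unlabeled tree. A binary search tree is a binary tree with nodes labeled in $A$ such that each node's label is $\ge$ all labels of its left subtree and $<$ all labels of its right subtree. $\mathrm{bst}(w)$ is obtained by reading $w$ from right to left and inserting each letter $x$: into an empty tree create a node labeled $x$; otherwise insert recursively into the left subtree if $x\le$ root label, into the right subtree if $x>$ root label. A decreasing tree is a labeled tree in which each node's label is greater than the labels of its children; it is standard if its labels are exactly $1,\dots,n$ where $n$ is the number of nodes. For a word $w$ without repeated letters, $\mathcal{T}(w)$ is empty if $w$ is empty, and otherwise has root labeled by the greatest letter $m$ of $w$ and, writing $w=u\,m\,v$,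 left subtree $\mathcal{T}(u)$ and right subtree $\mathcal{T}(v)$. *)

theory Defs
  imports "HOL-Library.Tree" "HOL-Combinatorics.Permutations"
begin

text \<open>Positions of a word are numbered from 1, in the order in which they receive the labels
  $1, 2, \ldots$ of the standardization.\<close>

definition labelling_order :: "'a::linorder list \<Rightarrow> nat list" where
  "labelling_order w =
     concat (map (\<lambda>a. filter (\<lambda>i. w ! (i - 1) = a) [1..<Suc (length w)])
                 (sorted_list_of_set (set w)))"

text \<open>The standardization as a permutation of \<open>{1..length w}\<close>, fixing all other numbers.\<close>

definition std :: "'a::linorder list \<Rightarrow> nat \<Rightarrow> nat" where
  "std w i =
     (if i \<in> {1..length w} then Suc (length (takeWhile (\<lambda>j. j \<noteq> i) (labelling_order w))) else i)"

lemma length_takeWhile_neq_less: "a \<in> set xs \<Longrightarrow> length (takeWhile (\<lambda>x. x \<noteq> a) xs) < length xs"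
  by (induction xs) auto

lemma set_labelling_order: "set (labelling_order w) = {1..length w}"
  by (auto simp: labelling_order_def)

lemma distinct_labelling_order: "distinct (labelling_order w)"
proof -
  have "distinct (concat (map (\<lambda>a. filter (\<lambda>i. w ! (i - 1) = a) [1..<Suc (length w)]) as))"
    if "distinct as" for as :: "'a list"
    using that by (induction as) auto
  then show ?thesis by (simp add: labelling_order_def)
qed

lemma std_permutes: "std w permutes {1..length w}"
proof -
  let ?L = "labelling_order w"
  let ?k = "\<lambda>i. length (takeWhile (\<lambda>j. j \<noteq> i) ?L)"
  have len: "length ?L = length w"
    using distinct_card[OF distinct_labelling_order, of w] by (simp add: set_labelling_order)
  have k: "?k i < length w \<and> ?L ! ?k i = i" if "i \<in> {1..length w}" for i
  proof -
    have "?k i < length ?L"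
      using that by (intro length_takeWhile_neq_less) (simp add: set_labelling_order)
    with nth_length_takeWhile[OF this] show ?thesis by (simp add: len)
  qed
  have "inj_on (std w) {1..length w}"
  proof (rule inj_onI)
    fix i j assume ij: "i \<in> {1..length w}" "j \<in> {1..length w}" "std w i = std w j"
    then have "?k i = ?k j" by (simp add: std_def)
    then show "i = j" using k[OF ij(1)] k[OF ij(2)] by metis
  qed
  moreover have "std w ` {1..length w} \<subseteq> {1..length w}"
    using k by (fastforce simp: std_def)
  ultimately have "bij_betw (std w) {1..length w} {1..length w}"
    by (simp add: bij_betw_def endo_inj_surj)
  then show ?thesis
    by (rule bij_imp_permutes) (auto simp: std_def)
qed

definition one_line :: "nat \<Rightarrow> (nat \<Rightarrow> nat) \<Rightarrow> nat list" where
  "one_line n \<sigma> = map \<sigma> [1..<Suc n]"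

definition shape :: "'a tree \<Rightarrow> unit tree" where
  "shape = map_tree (\<lambda>_. ())"

text \<open>The predicate \<open>bst\<close> of the library is strict on both sides; here labels equal to the root
  are allowed in the left subtree.\<close>

fun is_bst :: "'a::linorder tree \<Rightarrow> bool" where
  "is_bst \<langle>\<rangle> = True"
| "is_bst \<langle>l, x, r\<rangle> =
     ((\<forall>y\<in>set_tree l. y \<le> x) \<and> (\<forall>y\<in>set_tree r. x < y) \<and> is_bst l \<and> is_bst r)"

fun bst_insert :: "'a::linorder \<Rightarrow> 'a tree \<Rightarrow> 'a tree" where
  "bst_insert x \<langle>\<rangle> = \<langle>\<langle>\<rangle>, x, \<langle>\<rangle>\<rangle>"
| "bst_insert x \<langle>l, y, r\<rangle> =
     (if x \<le> y then \<langle>bst_insert x l, y, r\<rangle> else \<langle>l, y, bst_insert x r\<rangle>)"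

definition bst_of_word :: "'a::linorder list \<Rightarrow> 'a tree" where
  "bst_of_word w = foldr bst_insert w \<langle>\<rangle>"

fun decreasing_tree :: "'a::linorder tree \<Rightarrow> bool" where
  "decreasing_tree \<langle>\<rangle> = True"
| "decreasing_tree \<langle>l, x, r\<rangle> =
     ((l \<noteq> \<langle>\<rangle> \<longrightarrow> value l < x) \<and> (r \<noteq> \<langle>\<rangle> \<longrightarrow> value r < x) \<and> decreasing_tree l \<and> decreasing_tree r)"

definition standard_decreasing_tree :: "nat tree \<Rightarrow> bool" where
  "standard_decreasing_tree t \<longleftrightarrow> decreasing_tree t \<and> set_tree t = {1..size t}"

text \<open>Intended for words without repeated letters: \<open>w\<close> is split at the (first) occurrence of its
  greatest letter.\<close>

function decreasing_tree_of :: "'a::linorder list \<Rightarrow> 'a tree" where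
  "decreasing_tree_of w =
     (if w = [] then \<langle>\<rangle>
      else let m = Max (set w) in
        \<langle>decreasing_tree_of (takeWhile (\<lambda>x. x \<noteq> m) w), m,
         decreasing_tree_of (tl (dropWhile (\<lambda>x. x \<noteq> m) w))\<rangle>)"
  by auto
termination
proof (relation "measure length", goal_cases)
  case (2 w m)
  then show ?case by (simp add: length_takeWhile_neq_less)
next
  case (3 w m)
  then have "length (dropWhile (\<lambda>x. x \<noteq> m) w) - 1 < length w"
    using length_dropWhile_le[of "\<lambda>x. x \<noteq> m" w] by (cases w) auto
  then show ?case by simp
qed simp

declare decreasing_tree_of.simps [simp del]

definition SSA :: "'a::linorder list \<Rightarrow> 'a tree \<times> nat tree" where
  "SSA w = (bst_of_word w, decreasing_tree_of (one_line (length w) (inv (std w))))"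

text \<open>A node is given by the path leading to it from the root.\<close>

datatype side = Lft | Rgt

fun label_at :: "'a tree \<Rightarrow> side list \<Rightarrow> 'a option" where
  "label_at \<langle>\<rangle> p = None"
| "label_at \<langle>l, x, r\<rangle> [] = Some x"
| "label_at \<langle>l, x, r\<rangle> (Lft # p) = label_at l p"
| "label_at \<langle>l, x, r\<rangle> (Rgt # p) = label_at r p"

fun SSB :: "'a tree \<times> nat tree \<Rightarrow> 'a list" where
  "SSB (t1, t2) =
     map (\<lambda>i. the (label_at t1 (THE p. label_at t2 p = Some i))) [1..<Suc (size t2)]"

definition SS_pairs :: "nat \<Rightarrow> ('a::linorder tree \<times> nat tree) set" where
  "SS_pairs n =
     {(t1, t2). is_bst t1 \<and> size t1 = n \<and> standard_decreasing_tree t2 \<and> shape t2 = shape t1}"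

end

theory Submission
  imports Defs "HOL-Library.Product_Lexorder"
begin

text \<open>Replace the word \<open>w\<close> by the word of pairs (letter, position), ordered lexicographically, and
  insert these pairs into a binary search tree. Positions are inserted in decreasing order, so
  comparing pairs amounts to comparing letters by the rule of \<open>bst_insert\<close>, and the tree of pairs
  is decreasing in the positions. Its letters form \<open>bst(w)\<close>. Its inorder reading is the sorted
  sequence of pairs, whose positions are the one-line notation of the inverse of \<open>std(w)\<close>; as a
  decreasing tree is determined by its inorder reading, its positions form the second tree.
  Conversely, a pair of trees of the same shape, superposed, is such a tree of pairs, and it is
  determined by its set of labels, that is, by the word.\<close>

section \<open>Decreasing trees\<close>

text \<open>The definition compares a label only with the roots of its two subtrees. Since the root
  of a decreasing tree is its greatest label, the comparison extends to all labels below; later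
  inductions use this form.\<close>

lemma decreasing_tree_Node_iff:
  "decreasing_tree \<langle>l, x, r\<rangle> \<longleftrightarrow>
     (\<forall>y\<in>set_tree l. y < x) \<and> (\<forall>y\<in>set_tree r. y < x) \<and> decreasing_tree l \<and> decreasing_tree r"
proof -
  have root_greatest: "y \<le> value t" if "decreasing_tree t" "y \<in> set_tree t" for t :: "'a tree" and y
    using that
  proof (induction t)
    case (Node l z r)
    from Node.prems(2) consider "y = z" | "y \<in> set_tree l" | "y \<in> set_tree r" by auto
    then show ?case
    proof cases
      case 2
      then have "y \<le> value l" "value l < z" using Node by auto
      then show ?thesis by simp
    next
      case 3
      then have "y \<le> value r" "value r < z" using Node by auto
      then show ?thesis by simp
    qed simp
  qed simp
  have "value t \<in> set_tree t" if "t \<noteq> \<langle>\<rangle>" for t :: "'a tree"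
    using that by (cases t) auto
  then show ?thesis
    using root_greatest[of l] root_greatest[of r] by (auto dest: le_less_trans)
qed

text \<open>The root is the maximum of the reading, and cutting the reading there gives the readings
  of the two subtrees. Hence decreasing trees with equal readings coincide.\<close>

lemma decreasing_tree_of_inorder:
  assumes "decreasing_tree t"
  shows "decreasing_tree_of (inorder t) = t"
  using assms
proof (induction t)
  case Leaf
  then show ?case by (simp add: decreasing_tree_of.simps)
next
  case (Node l x r)
  let ?w = "inorder \<langle>l, x, r\<rangle>"
  have less: "\<forall>y\<in>set_tree l. y < x" "\<forall>y\<in>set_tree r. y < x"
    and IH: "decreasing_tree_of (inorder l) = l" "decreasing_tree_of (inorder r) = r"
    using Node by (auto simp only: decreasing_tree_Node_iff)
  have "Max (set ?w) = x"
    by (rule Max_eqI) (use less in auto)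
  moreover have "takeWhile (\<lambda>y. y \<noteq> x) ?w = inorder l" "dropWhile (\<lambda>y. y \<noteq> x) ?w = x # inorder r"
    using less by (auto simp: takeWhile_append dropWhile_append)
  ultimately show ?case
    using IH by (subst decreasing_tree_of.simps) (simp add: Let_def)
qed

section \<open>Superposed trees\<close>

text \<open>Equality of the mapped trees is used only for the shape: left subtrees have equal size,
  so the two readings break at the same place.\<close>

lemma tree_eq_if_map_tree_eq_inorder_eq:
  assumes "map_tree f s = map_tree f t" "inorder s = inorder t"
  shows "s = t"
  using assms
proof (induction s arbitrary: t)
  case Leaf
  then show ?case by (cases t) auto
next
  case (Node l x r)
  then obtain l' y r' where t: "t = \<langle>l', y, r'\<rangle>" by (cases t) auto
  with Node.prems have map_eq: "map_tree f l = map_tree f l'" "map_tree f r = map_tree f r'"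
    by auto
  then have "length (inorder l) = length (inorder l')"
    by (metis length_inorder size_map_tree)
  then have "inorder l = inorder l'" "x = y" "inorder r = inorder r'"
    using Node.prems(2) t by auto
  then show ?case
    using t map_eq Node.IH by auto
qed

lemma superposed_tree_exists:
  assumes "shape t2 = shape t1"
  obtains t where "map_tree fst t = t1" "map_tree snd t = t2"
proof -
  have "\<exists>t. map_tree fst t = t1 \<and> map_tree snd t = t2"
    using assms
  proof (induction t1 arbitrary: t2)
    case Leaf
    then have "t2 = \<langle>\<rangle>" by (cases t2) (auto simp: shape_def)
    then show ?case by (intro exI[of _ Leaf]) simp
  next
    case (Node l x r)
    then obtain l' y r' where t2: "t2 = \<langle>l', y, r'\<rangle>" "shape l' = shape l" "shape r' = shape r"
      by (cases t2) (auto simp: shape_def)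
    with Node.IH obtain tl tr where
      "map_tree fst tl = l" "map_tree snd tl = l'" "map_tree fst tr = r" "map_tree snd tr = r'"
      by metis
    with t2 show ?case by (intro exI[of _ "\<langle>tl, (x, y), tr\<rangle>"]) simp
  qed
  then show ?thesis using that by blast
qed

lemma label_at_map_tree: "label_at (map_tree f t) p = map_option f (label_at t p)"
  by (induction t p rule: label_at.induct) auto

lemma label_at_in_set_tree: "label_at t p = Some x \<Longrightarrow> x \<in> set_tree t"
  by (induction t p rule: label_at.induct) auto

lemma in_set_tree_label_at:
  assumes "x \<in> set_tree t"
  obtains p where "label_at t p = Some x"
proof -
  have "\<exists>p. label_at t p = Some x"
    using assms
  proof (induction t)
    case (Node l y r)
    then consider "x = y" | p where "label_at l p = Some x" | p where "label_at r p = Some x"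
      by auto
    then show ?case
      by cases (metis label_at.simps(2,3,4))+
  qed simp
  then show ?thesis using that by blast
qed

text \<open>Makes the \<open>THE\<close> in \<open>SSB\<close> well defined: a label lies either at
  the root or in exactly one subtree, so two paths to it take the same turn at every node.\<close>

lemma label_at_inj:
  assumes "distinct (inorder t)" "label_at t p = Some x" "label_at t q = Some x"
  shows "p = q"
  using assms
proof (induction t arbitrary: p q)
  case (Node l y r)
  have path_cases: "s = [] \<and> x = y \<or>
      (\<exists>s'. s = Lft # s' \<and> label_at l s' = Some x \<and> x \<in> set_tree l) \<or>
      (\<exists>s'. s = Rgt # s' \<and> label_at r s' = Some x \<and> x \<in> set_tree r)"
    if "label_at \<langle>l, y, r\<rangle> s = Some x" for s
  proof (cases s)
    case (Cons d s')
    then show ?thesis using that by (cases d) (auto dest: label_at_in_set_tree)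
  qed (use that in simp)
  have "y \<notin> set_tree l" "y \<notin> set_tree r" "set_tree l \<inter> set_tree r = {}"
    "distinct (inorder l)" "distinct (inorder r)"
    using Node.prems(1) by auto
  then show ?case
    using path_cases[OF Node.prems(2)] path_cases[OF Node.prems(3)] Node.IH by blast
qed simp

text \<open>The path to the node \<open>(a, i)\<close> of \<open>t\<close> is the only one leading
  to \<open>i\<close> in the second component, and it leads to \<open>a\<close> in the
  first.\<close>

lemma the_label_at_superposed:
  assumes dist: "distinct (inorder (map_tree snd t))" and mem: "(a, i) \<in> set_tree t"
  shows "the (label_at (map_tree fst t) (THE p. label_at (map_tree snd t) p = Some i)) = a"
proof -
  from mem obtain p where p: "label_at t p = Some (a, i)" by (rule in_set_tree_label_at)
  then have "label_at (map_tree snd t) p = Some i" by (simp add: label_at_map_tree)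
  then have "(THE p. label_at (map_tree snd t) p = Some i) = p"
    using label_at_inj[OF dist] by blast
  with p show ?thesis by (simp add: label_at_map_tree)
qed

section \<open>Binary search trees\<close>

lemma set_tree_bst_insert: "set_tree (bst_insert x t) = insert x (set_tree t)"
  by (induction t) auto

lemma is_bst_bst_insert: "is_bst t \<Longrightarrow> is_bst (bst_insert x t)"
  by (induction t) (auto simp: set_tree_bst_insert)

lemma bst_of_word_Cons: "bst_of_word (x # w) = bst_insert x (bst_of_word w)"
  by (simp add: bst_of_word_def)

lemma is_bst_bst_of_word: "is_bst (bst_of_word w)"
  by (induction w) (auto simp: bst_of_word_def is_bst_bst_insert)

lemma mset_inorder_bst_insert: "mset (inorder (bst_insert x t)) = add_mset x (mset (inorder t))"
  by (induction t) auto

lemma mset_inorder_bst_of_word: "mset (inorder (bst_of_word w)) = mset w"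
  by (induction w) (auto simp: bst_of_word_def mset_inorder_bst_insert)

lemma set_tree_bst_of_word: "set_tree (bst_of_word w) = set w"
  by (metis mset_inorder_bst_of_word set_inorder set_mset_mset)

lemma sorted_inorder_if_is_bst: "is_bst t \<Longrightarrow> sorted (inorder t)"
proof (induction t)
  case (Node l x r)
  then have "\<forall>y\<in>set_tree l. y \<le> x" "\<forall>y\<in>set_tree r. x \<le> y" by (auto intro: less_imp_le)
  with Node show ?case by (auto simp: sorted_append intro: order_trans)
qed simp

text \<open>In the left subtree letters may tie with the root; the smaller second component then
  makes the pair smaller. In the right subtree the letters alone decide.\<close>

lemma is_bst_superposed:
  fixes t :: "('a::linorder \<times> 'b::linorder) tree"
  assumes "is_bst (map_tree fst t)" "decreasing_tree (map_tree snd t)"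
  shows "is_bst t"
  using assms
proof (induction t)
  case (Node l x r)
  then have
    "\<forall>y\<in>set_tree l. fst y \<le> fst x \<and> snd y < snd x" "\<forall>y\<in>set_tree r. fst x < fst y"
    "is_bst l" "is_bst r"
    by (simp_all del: decreasing_tree.simps add: decreasing_tree_Node_iff tree.set_map)
  then show ?case
    by (auto simp: prod_le_def prod_less_def)
qed simp

text \<open>In the lexicographic order, ties between letters are decided by the positions, and lead to
  the left subtree.\<close>

lemma map_tree_fst_bst_insert:
  assumes "\<forall>q\<in>set_tree t. i < snd q"
  shows "map_tree fst (bst_insert (a, i) t) = bst_insert a (map_tree fst t)"
  using assms by (induction t) (auto simp: prod_le_def)

text \<open>The new node is a leaf whose second component lies below all others, so it may hang
  under any node.\<close>

lemma decreasing_tree_bst_insert: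
  fixes t :: "('a::linorder \<times> 'b::linorder) tree"
  assumes "\<forall>q\<in>set_tree t. i < snd q" "decreasing_tree (map_tree snd t)"
  shows "decreasing_tree (map_tree snd (bst_insert (a, i) t))"
  using assms
  by (induction t)
    (auto simp del: decreasing_tree.simps(2)
      simp: decreasing_tree_Node_iff tree.set_map set_tree_bst_insert)

text \<open>Insertion runs from right to left, so each new pair has a second component below all
  those already in the tree, as the two insertion lemmas require.\<close>

lemma bst_of_word_pairs:
  fixes xs :: "('a::linorder \<times> 'b::linorder) list"
  assumes "sorted_wrt (<) (map snd xs)"
  shows "map_tree fst (bst_of_word xs) = bst_of_word (map fst xs)"
    and "decreasing_tree (map_tree snd (bst_of_word xs))"
proof -
  have "map_tree fst (bst_of_word xs) = bst_of_word (map fst xs) \<and>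
      decreasing_tree (map_tree snd (bst_of_word xs))"
    using assms
  proof (induction xs)
    case Nil
    then show ?case by (simp add: bst_of_word_def)
  next
    case (Cons x xs)
    obtain a i where x: "x = (a, i)" by (cases x)
    have "\<forall>q\<in>set_tree (bst_of_word xs). i < snd q"
      using Cons.prems x by (auto simp: set_tree_bst_of_word)
    with Cons x show ?case
      by (simp add: bst_of_word_Cons map_tree_fst_bst_insert decreasing_tree_bst_insert)
  qed
  then show "map_tree fst (bst_of_word xs) = bst_of_word (map fst xs)"
    and "decreasing_tree (map_tree snd (bst_of_word xs))" by auto
qed

section \<open>Standardization\<close>

lemma length_labelling_order: "length (labelling_order w) = length w"
  using distinct_card[OF distinct_labelling_order, of w] by (simp add: set_labelling_order)

text \<open>\<open>std w\<close> sends a position to its rank in the labelling order, so the inverse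
  sends each rank to the position found there.\<close>

lemma one_line_inv_std: "one_line (length w) (inv (std w)) = labelling_order w"
proof (rule nth_equalityI)
  show "length (one_line (length w) (inv (std w))) = length (labelling_order w)"
    by (simp add: one_line_def length_labelling_order del: upt_Suc)
next
  fix k assume "k < length (one_line (length w) (inv (std w)))"
  then have k: "k < length w" by (simp add: one_line_def del: upt_Suc)
  let ?L = "labelling_order w"
  let ?m = "length (takeWhile (\<lambda>j. j \<noteq> ?L ! k) ?L)"
  have mem: "?L ! k \<in> set ?L"
    using k by (simp add: length_labelling_order)
  then have "?m < length ?L" by (rule length_takeWhile_neq_less)
  moreover from nth_length_takeWhile[OF this] have "?L ! ?m = ?L ! k" by simp
  \<comment> \<open>\<open>?m\<close> is the index of the first occurrence of the entry at
    \<open>k\<close>, and entries do not repeat.\<close>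
  ultimately have "?m = k"
    using k by (simp add: nth_eq_iff_index_eq[OF distinct_labelling_order] length_labelling_order)
  then have "std w (?L ! k) = Suc k"
    using mem by (simp add: std_def set_labelling_order)
  then have "inv (std w) (Suc k) = ?L ! k"
    using permutes_inv_eq[OF std_permutes] by metis
  then show "one_line (length w) (inv (std w)) ! k = ?L ! k"
    using k by (simp add: one_line_def del: upt_Suc)
qed

text \<open>Letters increase strictly from block to block; inside a block the letter is constant and
  the positions increase.\<close>

lemma sorted_labelled_positions: "sorted (map (\<lambda>i. (w ! (i - 1), i)) (labelling_order w))"
proof -
  have "sorted (map (\<lambda>i. (w ! (i - 1), i)) (filter (\<lambda>i. w ! (i - 1) = a) is))"
    if "sorted is" for a and "is" :: "nat list"
    using that by (induction "is") auto
  then have "sorted (map (\<lambda>i. (w ! (i - 1), i))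
      (concat (map (\<lambda>a. filter (\<lambda>i. w ! (i - 1) = a) [1..<Suc (length w)]) as)))"
    if "sorted_wrt (<) as" for as
    using that by (induction as) (auto simp: sorted_append simp del: upt_Suc)
  then show ?thesis
    using strict_sorted_list_of_set unfolding labelling_order_def by blast
qed

definition positioned_word :: "'a list \<Rightarrow> ('a \<times> nat) list" where
  "positioned_word w = zip w [1..<Suc (length w)]"

lemma set_positioned_word: "set (positioned_word w) = (\<lambda>i. (w ! (i - 1), i)) ` {1..length w}"
proof (intro set_eqI)
  fix p :: "'a \<times> nat"
  obtain a i where p: "p = (a, i)" by (cases p)
  have "p \<in> set (positioned_word w) \<longleftrightarrow> (\<exists>k<length w. a = w ! k \<and> i = Suc k)"
    unfolding p positioned_word_def by (auto simp: set_zip simp del: upt_Suc)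
  also have "\<dots> \<longleftrightarrow> p \<in> (\<lambda>i. (w ! (i - 1), i)) ` {1..length w}"
    unfolding p by (auto simp: image_iff intro: bexI[of _ i]) (metis One_nat_def Suc_le_D Suc_le_lessD diff_Suc_1)
  finally show "p \<in> set (positioned_word w) \<longleftrightarrow> \<dots>" .
qed

text \<open>A sorted list without repetitions is determined by its set. The tree is arbitrary, so
  that this covers both the tree built from \<open>w\<close> and the superposition of a given
  pair.\<close>

lemma inorder_eq_labelled_positions:
  assumes "is_bst t" "distinct (inorder t)" "set_tree t = set (positioned_word w)"
  shows "inorder t = map (\<lambda>i. (w ! (i - 1), i)) (labelling_order w)"
proof (rule sorted_distinct_set_unique)
  show "sorted (inorder t)" using assms(1) by (rule sorted_inorder_if_is_bst)
  show "distinct (map (\<lambda>i. (w ! (i - 1), i)) (labelling_order w))"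
    by (auto simp: distinct_map distinct_labelling_order inj_on_def)
  show "set (inorder t) = set (map (\<lambda>i. (w ! (i - 1), i)) (labelling_order w))"
    using assms(3) by (simp add: set_positioned_word set_labelling_order)
qed (use assms sorted_labelled_positions in auto)

section \<open>The correspondence\<close>

text \<open>The superposition of the two components of \<open>SSA w\<close>, as
  \<open>SSA_eq_components_positioned_tree\<close> shows.\<close>

definition positioned_tree :: "'a::linorder list \<Rightarrow> ('a \<times> nat) tree" where
  "positioned_tree w = bst_of_word (positioned_word w)"

lemma set_tree_positioned_tree: "set_tree (positioned_tree w) = set (positioned_word w)"
  by (simp add: positioned_tree_def set_tree_bst_of_word)

lemma inorder_positioned_tree:
  "inorder (positioned_tree w) = map (\<lambda>i. (w ! (i - 1), i)) (labelling_order w)"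
proof (rule inorder_eq_labelled_positions)
  have "distinct (positioned_word w)"
    by (simp add: positioned_word_def distinct_zipI2 del: upt_Suc)
  then show "distinct (inorder (positioned_tree w))"
    by (metis positioned_tree_def mset_inorder_bst_of_word mset_eq_imp_distinct_iff)
qed (simp_all add: positioned_tree_def set_tree_bst_of_word is_bst_bst_of_word)

lemma positioned_tree_components:
  shows fst_positioned_tree: "map_tree fst (positioned_tree w) = bst_of_word w"
    and decreasing_positioned_tree: "decreasing_tree (map_tree snd (positioned_tree w))"
  using bst_of_word_pairs[of "positioned_word w"]
  by (simp_all add: positioned_tree_def positioned_word_def del: upt_Suc)

lemma inorder_snd_positioned_tree:
  "inorder (map_tree snd (positioned_tree w)) = labelling_order w"
  by (simp add: inorder_map inorder_positioned_tree comp_def)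

text \<open>The tree of positions is decreasing and its reading is the one-line notation of the
  inverse of \<open>std w\<close>, so it is the tree that \<open>decreasing_tree_of\<close> builds
  from that notation.\<close>

lemma SSA_eq_components_positioned_tree:
  "SSA w = (map_tree fst (positioned_tree w), map_tree snd (positioned_tree w))"
  using decreasing_tree_of_inorder[OF decreasing_positioned_tree, of w]
  by (simp add: SSA_def one_line_inv_std fst_positioned_tree inorder_snd_positioned_tree)

lemma size_positioned_tree: "size (positioned_tree w) = length w"
  using arg_cong[OF inorder_positioned_tree[of w], of length] by (simp add: length_labelling_order)

lemma SSA_in_SS_pairs: "SSA w \<in> SS_pairs (length w)"
proof -
  have "set_tree (map_tree snd (positioned_tree w)) = {1..length w}"
    using arg_cong[OF inorder_snd_positioned_tree[of w], of set] by (simp add: set_labelling_order)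
  then show ?thesis
    using is_bst_bst_of_word[of w, folded fst_positioned_tree] decreasing_positioned_tree[of w]
    by (simp add: SSA_eq_components_positioned_tree SS_pairs_def standard_decreasing_tree_def
        shape_def tree.map_comp comp_def size_positioned_tree)
qed

lemma SSB_SSA: "SSB (SSA w) = w"
proof (rule nth_equalityI)
  show "length (SSB (SSA w)) = length w"
    by (simp add: SSA_eq_components_positioned_tree size_positioned_tree del: upt_Suc)
next
  fix k assume "k < length (SSB (SSA w))"
  then have k: "k < length w"
    by (simp add: SSA_eq_components_positioned_tree size_positioned_tree del: upt_Suc)
  \<comment> \<open>List index \<open>k\<close> is position \<open>Suc k\<close>, and the node with
    this position carries the letter sought.\<close>
  then have "(w ! k, Suc k) \<in> set_tree (positioned_tree w)"
    by (force simp: set_tree_positioned_tree set_positioned_word)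
  then have "the (label_at (map_tree fst (positioned_tree w))
      (THE p. label_at (map_tree snd (positioned_tree w)) p = Some (Suc k))) = w ! k"
    by (intro the_label_at_superposed)
      (simp_all only: inorder_snd_positioned_tree distinct_labelling_order)
  then show "SSB (SSA w) ! k = w ! k"
    using k by (simp add: SSA_eq_components_positioned_tree size_positioned_tree del: upt_Suc)
qed

text \<open>The superposition of the pair is shown to equal the \<open>positioned_tree\<close> of
  the word that \<open>SSB\<close> reads off, which yields both components of \<open>SSA\<close> at
  once.\<close>

lemma SSA_SSB:
  assumes "(t1, t2) \<in> SS_pairs n"
  shows "length (SSB (t1, t2)) = n" and "SSA (SSB (t1, t2)) = (t1, t2)"
proof -
  from assms have bst: "is_bst t1" and size: "size t1 = n" and dec: "decreasing_tree t2"
    and labels: "set_tree t2 = {1..size t2}" and shape: "shape t2 = shape t1"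
    by (auto simp: SS_pairs_def standard_decreasing_tree_def)
  obtain t where t: "map_tree fst t = t1" "map_tree snd t = t2"
    using superposed_tree_exists[OF shape] .
  have size2: "size t2 = n" and size_t: "size t = n"
    using size t by auto
  show len: "length (SSB (t1, t2)) = n"
    by (simp add: size2 del: upt_Suc)
  \<comment> \<open>\<open>t2\<close> has as many distinct labels as nodes.\<close>
  have dist2: "distinct (inorder t2)"
    by (rule card_distinct) (simp add: labels)
  then have dist: "distinct (inorder t)"
    using t by (auto simp: inorder_map distinct_map)
  let ?w = "SSB (t1, t2)"
  \<comment> \<open>One inclusion is enough, as both sets have \<open>n\<close> elements.\<close>
  have "set_tree t \<subseteq> set (positioned_word ?w)"
  proof (rule subrelI)
    fix a i assume mem: "(a, i) \<in> set_tree t"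
    have "i \<in> snd ` set_tree t"
      using imageI[OF mem, of snd] by simp
    then have i: "i \<in> {1..n}"
      using labels by (simp only: size2 t(2)[symmetric] tree.set_map size_map_tree size_t)
    have "the (label_at t1 (THE p. label_at t2 p = Some i)) = a"
      using the_label_at_superposed[OF _ mem] dist2 unfolding t by blast
    with i have "?w ! (i - 1) = a"
      by (auto simp: size2 simp del: upt_Suc)
    with i show "(a, i) \<in> set (positioned_word ?w)"
      unfolding set_positioned_word len by blast
  qed
  moreover have "card (set_tree t) = n"
    using distinct_card[OF dist] size_t by simp
  moreover have "card (set (positioned_word ?w)) = n"
    unfolding set_positioned_word len by (subst card_image) (auto simp: inj_on_def)
  ultimately have set_t: "set_tree t = set (positioned_word ?w)"
    by (intro card_subset_eq) auto
  have "is_bst t"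
    using bst dec t by (intro is_bst_superposed) simp_all
  then have inorder_t: "inorder t = inorder (positioned_tree ?w)"
    by (simp only: inorder_eq_labelled_positions[OF _ dist set_t] inorder_positioned_tree)
  \<comment> \<open>The trees of positions are decreasing with equal readings, hence equal. This
    fixes the shape, and the common reading of pairs then fixes the whole tree.\<close>
  then have "inorder (map_tree snd t) = inorder (map_tree snd (positioned_tree ?w))"
    by (simp only: inorder_map)
  then have "decreasing_tree_of (inorder (map_tree snd t)) =
      decreasing_tree_of (inorder (map_tree snd (positioned_tree ?w)))"
    by (rule arg_cong)
  then have "map_tree snd t = map_tree snd (positioned_tree ?w)"
    unfolding decreasing_tree_of_inorder[OF dec[folded t(2)]]
      decreasing_tree_of_inorder[OF decreasing_positioned_tree] .
  then have "positioned_tree ?w = t"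
    using inorder_t by (rule tree_eq_if_map_tree_eq_inorder_eq[symmetric])
  then show "SSA ?w = (t1, t2)"
    by (simp only: SSA_eq_components_positioned_tree t)
qed

theorem mainTheorem3:
  fixes n :: nat
  assumes "infinite (UNIV :: 'a::linorder set)"
  shows "bij_betw SSA {w :: 'a list. length w = n} (SS_pairs n)
       \<and> (\<forall>w :: 'a list. length w = n \<longrightarrow> SSB (SSA w) = w)
       \<and> (\<forall>(t1 :: 'a tree, t2) \<in> SS_pairs n.
            length (SSB (t1, t2)) = n \<and> SSA (SSB (t1, t2)) = (t1, t2))"
proof (intro conjI)
  show inverse: "\<forall>(t1 :: 'a tree, t2) \<in> SS_pairs n.
      length (SSB (t1, t2)) = n \<and> SSA (SSB (t1, t2)) = (t1, t2)"
    using SSA_SSB by blast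
  show "bij_betw SSA {w :: 'a list. length w = n} (SS_pairs n)"
    by (rule bij_betw_byWitness[where f' = SSB])
      (use inverse SSA_in_SS_pairs in \<open>auto simp: SSB_SSA simp del: SSB.simps\<close>)
  show "\<forall>w :: 'a list. length w = n \<longrightarrow> SSB (SSA w) = w"
    by (simp add: SSB_SSA del: SSB.simps)
qed

end
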